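(* Consider the asymmetric log-GARCH$(p,q)$ model with innovations $(\eta_t)$ and the associated matrices $\boldsymbol{C}_t$ and $\boldsymbol{A}^{(\infty)}$ defined in the context. Assume that $\gamma(\mathbf{C})<0$ and that $\rho(\boldsymbol{A}^{(\infty)})<1$. Let $$\lambda=\max_{1\le i\le q}\{|\alpha_{i+}|\vee|\alpha_{i-}|\}\sum_{\ell\ge0}\|(\boldsymbol{A}^{(\infty)})^\ell\|<\infty,$$ and assume that for some $s>0$ $$E\left[\exp\left\{s(\lambda\vee1)|\log\eta_0^2|\right\}\right]<\infty.$$ Then the strictly stationary solution of the log-GARCH$(p,q)$ model satisfies $E|\epsilon_0|^{2s}<\infty$.
   Context: **Model.** The asymmetric log-GARCH$(p,q)$ model is, for $t\in\mathbb{Z}$, $$\epsilon_t=\sigma_t\eta_t,\qquad \log\sigma_t^2=\omega+\sum_{i=1}^q\left(\alpha_{i+}1_{\{\epsilon_{t-i}>0\}}+\alpha_{i-}1_{\{\epsilon_{t-i}<0\}}\right)\log\epsilon_{t-i}^2+\sum_{j=1}^p\beta_j\log\sigma_{t-j}^2,$$ where $\sigma_t>0$, the coefficients $\omega,\alpha_{i+},\alpha_{i-},\beta_j$ are real (no sign constraints), and $(\eta_t)_{t\in\mathbb{Z}}$ is a given iid sequence of real random variables with $E\eta_0=0$, $E\eta_0^2=1$. Convention: $\log 0=-\infty$, so that finiteness of a moment of $|\log\eta_0^2|$ entails $P(\eta_0=0)=0$. Write $\boldsymbol{\alpha}_+=(\alpha_{1+},\dots,\alpha_{q+})$, $\boldsymbol{\alpha}_-=(\alpha_{1-},\dots,\alpha_{q-})$,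 $\boldsymbol{\beta}=(\beta_1,\dots,\beta_p)$ (row vectors), and $a\vee b=\max\{a,b\}$. **Norm.** $\|\cdot\|$ is a fixed multiplicative matrix norm, i.e. $\|\boldsymbol{M}\boldsymbol{N}\|\le\|\boldsymbol{M}\|\|\boldsymbol{N}\|$. **Matrices $\boldsymbol{C}_t$.** $\boldsymbol{I}_k$ is the $k\times k$ identity, $\mathbf{0}$ denotes zero vectors/matrices of the indicated size. $\boldsymbol{C}_t$ is the $(2q+p)\times(2q+p)$ matrix $$\boldsymbol{C}_t=\begin{pmatrix}1_{\{\eta_t>0\}}\boldsymbol{\alpha}_+&1_{\{\eta_t>0\}}\boldsymbol{\alpha}_-&1_{\{\eta_t>0\}}\boldsymbol{\beta}\\ (\boldsymbol{I}_{q-1}\ \mathbf{0}_{q-1})&\mathbf{0}_{(q-1)\times q}&\mathbf{0}_{(q-1)\times p}\\ 1_{\{\eta_t<0\}}\boldsymbol{\alpha}_+&1_{\{\eta_t<0\}}\boldsymbol{\alpha}_-&1_{\{\eta_t<0\}}\boldsymbol{\beta}\\ \mathbf{0}_{(q-1)\times q}&(\boldsymbol{I}_{q-1}\ \mathbf{0}_{q-1})&\mathbf{0}_{(q-1)\times p}\\ \boldsymbol{\alpha}_+&\boldsymbol{\alpha}_-&\boldsymbol{\beta}\\ \mathbf{0}_{(p-1)\times q}&\mathbf{0}_{(p-1)\times q}&(\boldsymbol{I}_{p-1}\ \mathbf{0}_{p-1})\end{pmatrix}$$ (with obvious changes, i.e. empty blocks dropped, when $p\le1$ or $q\le1$). $\gamma(\mathbf{C})=\lim_{t\to\infty}\frac1tE\log\|\boldsymbol{C}_t\cdots\boldsymbol{C}_1\|=\inf_{t\ge1}\frac1tE\log\|\boldsymbol{C}_t\cdots\boldsymbol{C}_1\|$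 is the top Lyapunov exponent of $\mathbf{C}=(\boldsymbol{C}_t)$. **Matrix $\boldsymbol{A}^{(\infty)}$.** Let $r=\max\{p,q\}$. With $\mu_i(\eta_t)=\alpha_{i+}1_{\{\eta_t>0\}}+\alpha_{i-}1_{\{\eta_t<0\}}+\beta_i$ for $1\le i\le r$, where $\alpha_{i+}=\alpha_{i-}=0$ for $i>q$ and $\beta_i=0$ for $i>p$, $\boldsymbol{A}_t$ is the $r\times r$ companion matrix $$\boldsymbol{A}_t=\begin{pmatrix}\mu_1(\eta_{t-1})\ \cdots\ \mu_{r-1}(\eta_{t-r+1})&\mu_r(\eta_{t-r})\\ \boldsymbol{I}_{r-1}&\mathbf{0}_{r-1}\end{pmatrix}.$$ $\mathrm{Abs}(\boldsymbol{M})$ is the matrix of absolute values of the entries of $\boldsymbol{M}$, and $\boldsymbol{A}^{(\infty)}=\mathrm{ess\,sup}\,\mathrm{Abs}(\boldsymbol{A}_1)$, the essential supremum being taken entry by entry. $\rho(\cdot)$ is the spectral radius. **Stationary solution.** When $\gamma(\mathbf{C})<0$ and $E\log^+|\log\eta_0^2|<\infty$, the model has a unique strictly stationary solution $(\epsilon_t,\sigma_t)_{t\in\mathbb{Z}}$, which is nonanticipative and ergodic; this is the solution referred to. *)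

theory Defs
  imports
    "HOL-Probability.Probability"
    "Jordan_Normal_Form.Spectral_Radius"
begin

section \<open>Extended logarithm, exponential and expectation\<close>

text \<open>The convention \<open>log 0 = -\<infinity>\<close> is needed both for \<open>log \<eta>\<^sub>0\<^sup>2\<close> and for
  \<open>log \<parallel>C\<^sub>t \<cdots> C\<^sub>1\<parallel>\<close>, as a product of the matrices \<open>C\<^sub>t\<close> may vanish. Arguments are
  nonnegative.\<close>

definition elog :: "real \<Rightarrow> ereal" where
  "elog x = (if x = 0 then - \<infinity> else ereal (ln x))"

definition eexp :: "ereal \<Rightarrow> ennreal" where
  "eexp x = (case x of ereal r \<Rightarrow> ennreal (exp r) | PInfty \<Rightarrow> \<infinity> | MInfty \<Rightarrow> 0)"

text \<open>\<open>E X = E X\<^sup>+ - E X\<^sup>-\<close>, meaningful when one of the two terms is finite;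
  \<^const>\<open>e2ennreal\<close> sends negative values to \<open>0\<close>.\<close>

definition ereal_expectation :: "'a measure \<Rightarrow> ('a \<Rightarrow> ereal) \<Rightarrow> ereal" where
  "ereal_expectation M X =
     enn2ereal (\<integral>\<^sup>+ w. e2ennreal (X w) \<partial>M) - enn2ereal (\<integral>\<^sup>+ w. e2ennreal (- X w) \<partial>M)"


section \<open>Matrix norms and the top Lyapunov exponent\<close>

definition multiplicative_norm :: "nat \<Rightarrow> (real mat \<Rightarrow> real) \<Rightarrow> bool" where
  "multiplicative_norm n N \<longleftrightarrow>
     (\<forall>A \<in> carrier_mat n n. 0 \<le> N A \<and> (N A = 0 \<longleftrightarrow> A = 0\<^sub>m n n)) \<and>
     (\<forall>A \<in> carrier_mat n n. \<forall>c. N (c \<cdot>\<^sub>m A) = \<bar>c\<bar> * N A) \<and>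
     (\<forall>A \<in> carrier_mat n n. \<forall>B \<in> carrier_mat n n. N (A + B) \<le> N A + N B) \<and>
     (\<forall>A \<in> carrier_mat n n. \<forall>B \<in> carrier_mat n n. N (A * B) \<le> N A * N B)"

text \<open>The product \<open>X\<^sub>t X\<^bsub>t-1\<^esub> \<cdots> X\<^sub>1\<close> of \<open>n \<times> n\<close> matrices.\<close>

primrec left_product :: "nat \<Rightarrow> (nat \<Rightarrow> real mat) \<Rightarrow> nat \<Rightarrow> real mat" where
  "left_product n X 0 = 1\<^sub>m n"
| "left_product n X (Suc t) = X (Suc t) * left_product n X t"

text \<open>For stationary ergodic sequences with \<open>E log\<^sup>+ \<parallel>X\<^sub>1\<parallel> < \<infinity>\<close>, the sequence
  \<open>1/t E log \<parallel>X\<^sub>t \<cdots> X\<^sub>1\<parallel>\<close> converges, by subadditivity, to its infimum. The infimum always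
  exists in \<^typ>\<open>ereal\<close> and is taken as the definition.\<close>

definition top_lyapunov ::
    "'a measure \<Rightarrow> (real mat \<Rightarrow> real) \<Rightarrow> nat \<Rightarrow> (nat \<Rightarrow> 'a \<Rightarrow> real mat) \<Rightarrow> ereal" where
  "top_lyapunov M N n X =
     (INF t \<in> {1..}. ereal (1 / real t) *
        ereal_expectation M (\<lambda>w. elog (N (left_product n (\<lambda>u. X u w) t))))"


section \<open>The asymmetric log-GARCH model\<close>

text \<open>The coefficients \<open>\<alpha>\<^bsub>i+\<^esub>\<close> (\<open>ap i\<close>), \<open>\<alpha>\<^bsub>i-\<^esub>\<close> (\<open>am i\<close>) and \<open>\<beta>\<^sub>j\<close> (\<open>b j\<close>) are
  indexed from \<open>1\<close>; only the values at \<open>1 \<le> i \<le> q\<close> and \<open>1 \<le> j \<le> p\<close> are ever used.\<close>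

definition iid_process :: "'a measure \<Rightarrow> (int \<Rightarrow> 'a \<Rightarrow> real) \<Rightarrow> bool" where
  "iid_process M \<eta> \<longleftrightarrow>
     prob_space.indep_vars M (\<lambda>_. borel) \<eta> UNIV \<and>
     (\<forall>t. distr M borel (\<eta> t) = distr M borel (\<eta> 0))"

text \<open>The real-valued \<^const>\<open>ln\<close> is adequate here: \<open>\<sigma>\<^sub>t > 0\<close>, and when \<open>\<epsilon>\<^bsub>t-i\<^esub> = 0\<close> both
  indicators vanish.\<close>

definition log_garch_solution ::
    "'a measure \<Rightarrow> (int \<Rightarrow> 'a \<Rightarrow> real) \<Rightarrow> nat \<Rightarrow> nat \<Rightarrow> real \<Rightarrow>
     (nat \<Rightarrow> real) \<Rightarrow> (nat \<Rightarrow> real) \<Rightarrow> (nat \<Rightarrow> real) \<Rightarrow>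
     (int \<Rightarrow> 'a \<Rightarrow> real) \<Rightarrow> (int \<Rightarrow> 'a \<Rightarrow> real) \<Rightarrow> bool" where
  "log_garch_solution M \<eta> p q \<omega> ap am b \<epsilon> \<sigma> \<longleftrightarrow>
     (\<forall>t. \<epsilon> t \<in> borel_measurable M \<and> \<sigma> t \<in> borel_measurable M) \<and>
     (\<forall>t. AE w in M.
        \<sigma> t w > 0 \<and>
        \<epsilon> t w = \<sigma> t w * \<eta> t w \<and>
        ln ((\<sigma> t w)\<^sup>2) = \<omega>
          + (\<Sum>i = 1..q. (ap i * of_bool (\<epsilon> (t - int i) w > 0) +
                         am i * of_bool (\<epsilon> (t - int i) w < 0)) * ln ((\<epsilon> (t - int i) w)\<^sup>2))
          + (\<Sum>j = 1..p. b j * ln ((\<sigma> (t - int j) w)\<^sup>2)))"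

definition strictly_stationary :: "'a measure \<Rightarrow> (int \<Rightarrow> 'a \<Rightarrow> 'b::topological_space) \<Rightarrow> bool" where
  "strictly_stationary M X \<longleftrightarrow>
     (\<forall>h. distr M (Pi\<^sub>M UNIV (\<lambda>_. borel)) (\<lambda>w t. X (t + h) w) =
          distr M (Pi\<^sub>M UNIV (\<lambda>_. borel)) (\<lambda>w t. X t w))"


section \<open>The matrices \<open>C\<^sub>t\<close> and \<open>A\<^sup>(\<^sup>\<infinity>\<^sup>)\<close>\<close>

text \<open>The row vector \<open>(\<alpha>\<^sub>+, \<alpha>\<^sub>-, \<beta>)\<close> of length \<open>2q + p\<close>, columns counted from \<open>0\<close>.\<close>

definition coeff_row ::
    "nat \<Rightarrow> (nat \<Rightarrow> real) \<Rightarrow> (nat \<Rightarrow> real) \<Rightarrow> (nat \<Rightarrow> real) \<Rightarrow> nat \<Rightarrow> real" where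
  "coeff_row q ap am b j =
     (if j < q then ap (j + 1)
      else if j < 2 * q then am (j - q + 1)
      else b (j - 2 * q + 1))"

text \<open>\<open>C\<^sub>t\<close> as a function of the value \<open>x\<close> of \<open>\<eta>\<^sub>t\<close>. The block rows start at rows \<open>0\<close>,
  \<open>q\<close> and \<open>2q\<close>; below the first row of each block, the blocks \<open>(I 0)\<close> put a \<open>1\<close> just left
  of the diagonal of the full matrix. If \<open>q = 0\<close>, the first two blocks are empty
  and row \<open>0\<close> is the row \<open>\<beta>\<close>; if \<open>p = 0\<close>, there is no row \<open>2q\<close>.\<close>

definition C_mat ::
    "nat \<Rightarrow> nat \<Rightarrow> (nat \<Rightarrow> real) \<Rightarrow> (nat \<Rightarrow> real) \<Rightarrow> (nat \<Rightarrow> real) \<Rightarrow> real \<Rightarrow> real mat" where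
  "C_mat p q ap am b x = Matrix.mat (2 * q + p) (2 * q + p) (\<lambda>(i, j).
     if i = 2 * q then coeff_row q ap am b j
     else if i = 0 then of_bool (x > 0) * coeff_row q ap am b j
     else if i = q then of_bool (x < 0) * coeff_row q ap am b j
     else of_bool (i = j + 1))"

definition mu ::
    "nat \<Rightarrow> nat \<Rightarrow> (nat \<Rightarrow> real) \<Rightarrow> (nat \<Rightarrow> real) \<Rightarrow> (nat \<Rightarrow> real) \<Rightarrow> nat \<Rightarrow> real \<Rightarrow> real" where
  "mu p q ap am b i x =
     (if i \<le> q then ap i * of_bool (x > 0) + am i * of_bool (x < 0) else 0) +
     (if i \<le> p then b i else 0)"

definition A_mat ::
    "(int \<Rightarrow> 'a \<Rightarrow> real) \<Rightarrow> nat \<Rightarrow> nat \<Rightarrow> (nat \<Rightarrow> real) \<Rightarrow> (nat \<Rightarrow> real) \<Rightarrow> (nat \<Rightarrow> real) \<Rightarrow>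
     int \<Rightarrow> 'a \<Rightarrow> real mat" where
  "A_mat \<eta> p q ap am b t w = Matrix.mat (max p q) (max p q) (\<lambda>(i, j).
     if i = 0 then mu p q ap am b (j + 1) (\<eta> (t - int (j + 1)) w)
     else of_bool (i = j + 1))"

text \<open>The entries of \<open>A\<^sub>1\<close> are bounded, so the essential suprema are finite.\<close>

definition A_inf ::
    "'a measure \<Rightarrow> (int \<Rightarrow> 'a \<Rightarrow> real) \<Rightarrow> nat \<Rightarrow> nat \<Rightarrow>
     (nat \<Rightarrow> real) \<Rightarrow> (nat \<Rightarrow> real) \<Rightarrow> (nat \<Rightarrow> real) \<Rightarrow> real mat" where
  "A_inf M \<eta> p q ap am b = Matrix.mat (max p q) (max p q) (\<lambda>(i, j).
     real_of_ereal (esssup M (\<lambda>w. ereal \<bar>A_mat \<eta> p q ap am b 1 w $$ (i, j)\<bar>)))"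

text \<open>The inserted \<open>0\<close> only matters for \<open>q = 0\<close>, where the maximum is over the empty set.\<close>

definition lambda_const ::
    "'a measure \<Rightarrow> (int \<Rightarrow> 'a \<Rightarrow> real) \<Rightarrow> (real mat \<Rightarrow> real) \<Rightarrow> nat \<Rightarrow> nat \<Rightarrow>
     (nat \<Rightarrow> real) \<Rightarrow> (nat \<Rightarrow> real) \<Rightarrow> (nat \<Rightarrow> real) \<Rightarrow> real" where
  "lambda_const M \<eta> N p q ap am b =
     Max (insert 0 ((\<lambda>i. max \<bar>ap i\<bar> \<bar>am i\<bar>) ` {1..q})) *
     (\<Sum>l. N (A_inf M \<eta> p q ap am b ^\<^sub>m l))"

end

theory Submission
  imports Defs
begin

text \<open>Let \<open>c\<^sub>1, \<dots>, c\<^sub>r\<close> be the first row of \<open>A\<^sup>(\<^sup>\<infinity>\<^sup>)\<close>, a nonnegative companion matrix, and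
  \<open>m = \<Sum> c\<^sub>k\<close>. By the intermediate value theorem \<open>x\<^sup>r = \<Sum> c\<^sub>k x\<^bsup>r-k\<^esup>\<close> has a root \<open>x\<close> between
  \<open>m\<close> and \<open>1\<close> if \<open>m \<le> 1\<close> and a root \<open>x \<ge> 1\<close> if \<open>m \<ge> 1\<close>, and this root is an eigenvalue. Hence
  \<open>m < 1\<close> and \<open>\<parallel>A\<^sup>l\<parallel> \<ge> m\<^sup>l\<close> for every multiplicative norm, so that \<open>\<lambda> \<ge> a / (1 - m)\<close>, where \<open>a\<close> is
  the largest \<open>|\<alpha>\<^bsub>i\<plusminus>\<^esub>|\<close>.

  Taking absolute values in the model equation,
  \<open>|ln \<sigma>\<^sub>t\<^sup>2| \<le> \<Sum> c\<^sub>k |ln \<sigma>\<^bsub>t-k\<^esub>\<^sup>2| + |\<omega>| + a \<Sum> |ln \<eta>\<^bsub>t-i\<^esub>\<^sup>2|\<close>. By convexity of \<open>exp\<close>,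
  \<open>U\<^sub>t = exp (s |ln \<sigma>\<^sub>t\<^sup>2|)\<close> then satisfies \<open>U\<^sub>t \<le> \<Sum> c\<^sub>k U\<^bsub>t-k\<^esub> + V\<^sub>t\<close>, where \<open>V\<^sub>t\<close> is a constant times
  the product of the \<open>exp (s \<lambda> |ln \<eta>\<^bsub>t-i\<^esub>\<^sup>2|)\<close>, \<open>1 \<le> i \<le> q\<close>. Iterating this inequality, with a
  remainder that vanishes in probability by stationarity, gives \<open>U\<^sub>0 \<le> \<Sum> \<theta>\<^sup>l V\<^bsub>-l\<^esub>\<close> for some
  \<open>\<theta> < 1\<close>. The right-hand side is independent of \<open>\<eta>\<^sub>0\<close> whether or not the solution is
  nonanticipative, and \<open>|\<epsilon>\<^sub>0|\<^bsup>2s\<^esup> \<le> U\<^sub>0 exp (s |ln \<eta>\<^sub>0\<^sup>2|)\<close>.\<close>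

section \<open>Nonnegative companion matrices\<close>

text \<open>The first row is indexed from 1, so that \<open>c k\<close> is the weight of lag k and
  x^r - \<Sum> c_k x^(r-k) is the characteristic polynomial.\<close>

definition companion :: "nat \<Rightarrow> (nat \<Rightarrow> 'a::zero_neq_one) \<Rightarrow> 'a mat" where
  "companion r c = Matrix.mat r r (\<lambda>(i, j). if i = 0 then c (j + 1) else of_bool (i = j + 1))"

lemma companion_carrier [simp]: "companion r c \<in> carrier_mat r r"
  by (simp add: companion_def)

text \<open>Row i of the matrix applied to the descending powers of x. The shift rows multiply by x
  for every x; only row 0 imposes a condition. A characteristic root thus gives an eigenvector, a
  subsolution \<theta> a vector contracted by \<theta>.\<close>

lemma sum_companion_powers:
  fixes c :: "nat \<Rightarrow> 'a::comm_ring_1"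
  assumes "i < r"
  shows "(\<Sum>j<r. companion r c $$ (i, j) * x ^ (r - 1 - j)) =
    (if i = 0 then (\<Sum>k = 1..r. c k * x ^ (r - k)) else x * x ^ (r - 1 - i))"
proof (cases "i = 0")
  case True
  have "(\<Sum>j<r. companion r c $$ (i, j) * x ^ (r - 1 - j)) = (\<Sum>j<r. c (Suc j) * x ^ (r - Suc j))"
    using assms True by (intro sum.cong) (auto simp: companion_def)
  also have "\<dots> = (\<Sum>k = 1..r. c k * x ^ (r - k))"
    by (simp add: sum.atLeast1_atMost_eq)
  finally show ?thesis using True by simp
next
  case False
  have "(\<Sum>j<r. companion r c $$ (i, j) * x ^ (r - 1 - j)) = (\<Sum>j<r. if j = i - 1 then x ^ (r - 1 - j) else 0)"
    using assms False by (intro sum.cong) (auto simp: companion_def)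
  also have "\<dots> = x ^ (r - 1 - (i - 1))"
    using assms False by (subst sum.delta) auto
  also have "r - 1 - (i - 1) = Suc (r - 1 - i)"
    using assms False by simp
  finally show ?thesis using False by simp
qed

lemma spectral_radius_companion_ge:
  fixes c :: "nat \<Rightarrow> real"
  assumes "r > 0" and root: "(\<Sum>k = 1..r. c k * x ^ (r - k)) = x ^ r"
  shows "\<bar>x\<bar> \<le> spectral_radius (map_mat complex_of_real (companion r c))"
proof -
  let ?A = "companion r c" and ?v = "Matrix.vec r (\<lambda>i. x ^ (r - 1 - i))"
  have "?A *\<^sub>v ?v = x \<cdot>\<^sub>v ?v"
  proof (rule eq_vecI)
    fix i assume "i < dim_vec (x \<cdot>\<^sub>v ?v)"
    then have i: "i < r" by simp
    have "vec_index (?A *\<^sub>v ?v) i = (\<Sum>j<r. ?A $$ (i, j) * x ^ (r - 1 - j))"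
      using i by (auto simp: scalar_prod_def companion_def lessThan_atLeast0)
    also have "\<dots> = x * x ^ (r - 1 - i)"
      using sum_companion_powers[OF i, of c x] root power_Suc[of x "r - 1"] i by auto
    finally show "vec_index (?A *\<^sub>v ?v) i = vec_index (x \<cdot>\<^sub>v ?v) i"
      using i by simp
  qed (simp add: companion_def)
  moreover have "?v \<noteq> 0\<^sub>v r"
  proof
    assume "?v = 0\<^sub>v r"
    then have "vec_index ?v (r - 1) = vec_index (0\<^sub>v r) (r - 1)" by simp
    then show False using \<open>r > 0\<close> by simp
  qed
  ultimately have "eigenvector ?A ?v x"
    by (simp add: eigenvector_def companion_def carrier_vecI)
  then have "eigenvalue (map_mat complex_of_real ?A) (complex_of_real x)"
    unfolding eigenvalue_def using of_real_hom.eigenvector_hom[OF companion_carrier] by blast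
  then have "\<bar>x\<bar> \<in> norm ` spectrum (map_mat complex_of_real ?A)"
    unfolding spectrum_def by (intro image_eqI[of _ _ "complex_of_real x"]) auto
  then show ?thesis
    using spectral_radius_mem_max(2)[of "map_mat complex_of_real ?A" r] \<open>r > 0\<close> by simp
qed

lemma companion_char_root:
  fixes c :: "nat \<Rightarrow> real"
  assumes "r > 0" and c: "\<And>k. 1 \<le> k \<Longrightarrow> k \<le> r \<Longrightarrow> 0 \<le> c k"
  defines "m \<equiv> \<Sum>k = 1..r. c k"
  obtains x where "m \<le> 1 \<Longrightarrow> m \<le> x" "m \<ge> 1 \<Longrightarrow> 1 \<le> x"
    "(\<Sum>k = 1..r. c k * x ^ (r - k)) = x ^ r"
proof -
  define f where "f x = x ^ r - (\<Sum>k = 1..r. c k * x ^ (r - k))" for x :: real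
  have cont: "continuous_on S f" for S
    unfolding f_def by (intro continuous_intros)
  have m0: "0 \<le> m" unfolding m_def using c by (intro sum_nonneg) auto
  have f1: "f 1 = 1 - m" by (simp add: f_def m_def)
  \<comment> \<open>The weights sum to m, so m^r = \<Sum> c_k m^(r-1). As r - k \<le> r - 1,
    comparing powers of m gives f m \<le> 0 if m \<le> 1 and f m \<ge> 0 if m \<ge> 1, opposite to f
    1 = 1 - m.\<close>
  have fm: "f m = (\<Sum>k = 1..r. c k * (m ^ (r - 1) - m ^ (r - k)))"
  proof -
    have "m ^ r = (\<Sum>k = 1..r. c k) * m ^ (r - 1)"
      using \<open>r > 0\<close> by (cases r) (simp_all add: m_def)
    then show ?thesis
      by (simp add: f_def sum_distrib_right sum_subtractf right_diff_distrib)
  qed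
  show thesis
  proof (cases "m \<le> 1")
    case True
    have "f m \<le> 0"
      unfolding fm using c m0 True
      by (intro sum_nonpos mult_nonneg_nonpos) (auto intro!: power_decreasing)
    then obtain x where "m \<le> x" "x \<le> 1" "f x = 0"
      using IVT'[of f m 0 1] f1 True cont by auto
    then show thesis using True by (intro that[of x]) (auto simp: f_def)
  next
    case False
    have "f m \<ge> 0"
      unfolding fm using c False
      by (intro sum_nonneg mult_nonneg_nonneg) (auto intro!: power_increasing)
    then obtain x where "1 \<le> x" "x \<le> m" "f x = 0"
      using IVT'[of f 1 0 m] f1 False cont by auto
    then show thesis using False by (intro that[of x]) (auto simp: f_def)
  qed
qed

lemma companion_sum_less_1:
  fixes c :: "nat \<Rightarrow> real"
  assumes "r > 0" and c: "\<And>k. 1 \<le> k \<Longrightarrow> k \<le> r \<Longrightarrow> 0 \<le> c k"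
    and "spectral_radius (map_mat complex_of_real (companion r c)) < 1"
  shows "(\<Sum>k = 1..r. c k) < 1"
proof (rule ccontr)
  assume m: "\<not> ?thesis"
  obtain x where "1 \<le> x" "(\<Sum>k = 1..r. c k * x ^ (r - k)) = x ^ r"
  proof (rule companion_char_root[of r c])
    fix x assume "1 \<le> (\<Sum>k = 1..r. c k) \<Longrightarrow> 1 \<le> x" "(\<Sum>k = 1..r. c k * x ^ (r - k)) = x ^ r"
    then show thesis using m by (intro that[of x]) simp_all
  qed (use assms in auto)
  then show False
    using spectral_radius_companion_ge[OF \<open>r > 0\<close>, of c x] assms(3) by simp
qed

lemma companion_pow_carrier [simp]: "companion r c ^\<^sub>m l \<in> carrier_mat r r"
  by simp

text \<open>A matrix norm dominates every real eigenvalue: apply it to a matrix with all columns equal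
  to an eigenvector.\<close>

lemma multiplicative_norm_companion_pow_ge:
  fixes c :: "nat \<Rightarrow> real"
  assumes N: "multiplicative_norm r N" and "r > 0"
    and root: "(\<Sum>k = 1..r. c k * x ^ (r - k)) = x ^ r" and "0 \<le> x"
  shows "x ^ l \<le> N (companion r c ^\<^sub>m l)"
proof -
  let ?A = "companion r c" and ?V = "Matrix.mat r r (\<lambda>(i, j). x ^ (r - 1 - i))"
  have V: "?V \<in> carrier_mat r r" by simp
  have AV: "?A * ?V = x \<cdot>\<^sub>m ?V"
  proof (rule eq_matI)
    fix i j assume "i < dim_row (x \<cdot>\<^sub>m ?V)" "j < dim_col (x \<cdot>\<^sub>m ?V)"
    then have i: "i < r" and j: "j < r" by auto
    have "(?A * ?V) $$ (i, j) = (\<Sum>j<r. ?A $$ (i, j) * x ^ (r - 1 - j))"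
      using i j by (auto simp: scalar_prod_def companion_def lessThan_atLeast0)
    also have "\<dots> = x * x ^ (r - 1 - i)"
      using sum_companion_powers[OF i, of c x] root power_Suc[of x "r - 1"] i by auto
    finally show "(?A * ?V) $$ (i, j) = (x \<cdot>\<^sub>m ?V) $$ (i, j)"
      using i j by simp
  qed (auto simp: companion_def)
  have pow: "(?A ^\<^sub>m l) * ?V = x ^ l \<cdot>\<^sub>m ?V"
  proof (induction l)
    case 0
    show ?case by (intro eq_matI) (auto simp: companion_def)
  next
    case (Suc l)
    have "(?A ^\<^sub>m Suc l) * ?V = (?A ^\<^sub>m l) * (?A * ?V)"
      using assoc_mult_mat[OF companion_pow_carrier companion_carrier V, of c l c] by simp
    also have "\<dots> = x \<cdot>\<^sub>m ((?A ^\<^sub>m l) * ?V)"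
      unfolding AV by (rule mult_smult_distrib[OF companion_pow_carrier V])
    also have "\<dots> = x ^ Suc l \<cdot>\<^sub>m ?V"
      unfolding Suc.IH by (intro eq_matI) auto
    finally show ?case .
  qed
  have "?V \<noteq> 0\<^sub>m r r"
  proof
    assume "?V = 0\<^sub>m r r"
    then have "?V $$ (r - 1, 0) = 0\<^sub>m r r $$ (r - 1, 0)" by simp
    then show False using \<open>r > 0\<close> by simp
  qed
  then have pos: "0 < N ?V"
    using N V unfolding multiplicative_norm_def by (metis less_eq_real_def)
  have "x ^ l * N ?V = N ((?A ^\<^sub>m l) * ?V)"
    unfolding pow using N V \<open>0 \<le> x\<close> unfolding multiplicative_norm_def by (auto simp: abs_of_nonneg)
  also have "\<dots> \<le> N (?A ^\<^sub>m l) * N ?V"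
    using N V companion_pow_carrier unfolding multiplicative_norm_def by blast
  finally show ?thesis using pos by (rule mult_right_le_imp_le)
qed

text \<open>Triangle inequality and homogeneity over elementary matrices, adding one position at a
  time. It turns entrywise decay into decay of the norm.\<close>

lemma multiplicative_norm_le_entries:
  assumes N: "multiplicative_norm r N" and A: "A \<in> carrier_mat r r"
  shows "N A \<le> (\<Sum>(i, j) \<in> {..<r} \<times> {..<r}.
           \<bar>A $$ (i, j)\<bar> * N (Matrix.mat r r (\<lambda>ij. of_bool (ij = (i, j)))))"
proof -
  define R where "R S = Matrix.mat r r (\<lambda>ij. if ij \<in> S then A $$ ij else 0)" for S
  define E where "E k = (Matrix.mat r r (\<lambda>ij. of_bool (ij = k)) :: real mat)" for k
  have "N (R S) \<le> (\<Sum>k \<in> S. \<bar>A $$ k\<bar> * N (E k))" if "finite S" for S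
    using that
  proof (induction S)
    case empty
    have "R {} = 0\<^sub>m r r" by (auto simp: R_def)
    moreover have "N (0\<^sub>m r r) = 0"
      using N zero_carrier_mat[of r r] unfolding multiplicative_norm_def by blast
    ultimately show ?case by simp
  next
    case (insert k S)
    have "R (insert k S) = R S + A $$ k \<cdot>\<^sub>m E k"
      using insert.hyps by (intro eq_matI) (auto simp: R_def E_def)
    moreover have "R S \<in> carrier_mat r r" "A $$ k \<cdot>\<^sub>m E k \<in> carrier_mat r r"
      by (simp_all add: R_def E_def)
    ultimately have "N (R (insert k S)) \<le> N (R S) + N (A $$ k \<cdot>\<^sub>m E k)"
      using N by (simp add: multiplicative_norm_def)
    also have "N (A $$ k \<cdot>\<^sub>m E k) = \<bar>A $$ k\<bar> * N (E k)"
      using N by (simp add: multiplicative_norm_def E_def)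
    finally show ?case using insert by simp
  qed
  from this[of "{..<r} \<times> {..<r}"] have "N (R ({..<r} \<times> {..<r})) \<le> (\<Sum>k \<in> {..<r} \<times> {..<r}. \<bar>A $$ k\<bar> * N (E k))"
    by simp
  moreover have "R ({..<r} \<times> {..<r}) = A"
    using A by (intro eq_matI) (auto simp: R_def)
  ultimately show ?thesis by (simp add: E_def case_prod_unfold)
qed

text \<open>The vector with entries \<open>\<theta>\<^bsup>r-1-i\<^esup>\<close> satisfies \<open>A v \<le> \<theta> v\<close> entry by entry.\<close>

lemma companion_pow_entry_le:
  fixes c :: "nat \<Rightarrow> real"
  assumes c: "\<And>k. 1 \<le> k \<Longrightarrow> k \<le> r \<Longrightarrow> 0 \<le> c k"
    and "0 < \<theta>" "\<theta> \<le> 1" and sub: "(\<Sum>k = 1..r. c k * \<theta> ^ (r - k)) \<le> \<theta> ^ r"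
    and i: "i < r" and j: "j < r"
  shows "\<bar>(companion r c ^\<^sub>m l) $$ (i, j)\<bar> \<le> \<theta> ^ l / \<theta> ^ (r - 1)"
proof -
  let ?A = "companion r c"
  have Anonneg: "0 \<le> ?A $$ (k, j)" if "k < r" "j < r" for k j
    using that c by (auto simp: companion_def)
  have Av: "(\<Sum>j<r. ?A $$ (k, j) * \<theta> ^ (r - 1 - j)) \<le> \<theta> * \<theta> ^ (r - 1 - k)" if "k < r" for k
    using sum_companion_powers[OF that, of c \<theta>] sub power_Suc[of \<theta> "r - 1"] that by auto
  have mult: "(?A ^\<^sub>m Suc l) $$ (i, j) = (\<Sum>k<r. (?A ^\<^sub>m l) $$ (i, k) * ?A $$ (k, j))"
    if "j < r" for l j
    using i that companion_pow_carrier[of r c l] companion_carrier[of r c]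
    by (simp add: scalar_prod_def lessThan_atLeast0 del: companion_carrier)
  have nonneg: "0 \<le> (?A ^\<^sub>m l) $$ (i, j)" if "j < r" for l j
    using that
  proof (induction l arbitrary: j)
    case 0
    then show ?case using i by (simp add: companion_def)
  next
    case (Suc l)
    then show ?case unfolding mult[OF Suc.prems]
      by (intro sum_nonneg mult_nonneg_nonneg Anonneg) auto
  qed
  have bound: "(\<Sum>j<r. (?A ^\<^sub>m l) $$ (i, j) * \<theta> ^ (r - 1 - j)) \<le> \<theta> ^ l * \<theta> ^ (r - 1 - i)"
  proof (induction l)
    case 0
    have "(\<Sum>j<r. (?A ^\<^sub>m 0) $$ (i, j) * \<theta> ^ (r - 1 - j)) = (\<Sum>j<r. if j = i then \<theta> ^ (r - 1 - j) else 0)"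
      using i by (intro sum.cong) (auto simp: companion_def)
    then show ?case using i by simp
  next
    case (Suc l)
    have "(\<Sum>j<r. (?A ^\<^sub>m Suc l) $$ (i, j) * \<theta> ^ (r - 1 - j)) =
        (\<Sum>j<r. \<Sum>k<r. (?A ^\<^sub>m l) $$ (i, k) * (?A $$ (k, j) * \<theta> ^ (r - 1 - j)))"
      using mult by (intro sum.cong) (auto simp: sum_distrib_right mult.assoc)
    also have "\<dots> = (\<Sum>k<r. (?A ^\<^sub>m l) $$ (i, k) * (\<Sum>j<r. ?A $$ (k, j) * \<theta> ^ (r - 1 - j)))"
      by (subst sum.swap) (simp add: sum_distrib_left)
    also have "\<dots> \<le> (\<Sum>k<r. (?A ^\<^sub>m l) $$ (i, k) * (\<theta> * \<theta> ^ (r - 1 - k)))"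
      using nonneg Av by (intro sum_mono mult_left_mono) auto
    also have "\<dots> = \<theta> * (\<Sum>k<r. (?A ^\<^sub>m l) $$ (i, k) * \<theta> ^ (r - 1 - k))"
      by (simp add: sum_distrib_left mult.left_commute)
    also have "\<dots> \<le> \<theta> * (\<theta> ^ l * \<theta> ^ (r - 1 - i))"
      using Suc.IH \<open>0 < \<theta>\<close> by simp
    finally show ?case by (simp add: mult.assoc)
  qed
  \<comment> \<open>Every weight is at least \<theta>^(r-1), so a single entry is recovered from the
    weighted row sum at the cost of this constant factor.\<close>
  have "(?A ^\<^sub>m l) $$ (i, j) * \<theta> ^ (r - 1) \<le> (?A ^\<^sub>m l) $$ (i, j) * \<theta> ^ (r - 1 - j)"
    using nonneg[OF j] \<open>0 < \<theta>\<close> \<open>\<theta> \<le> 1\<close> by (intro mult_left_mono power_decreasing) auto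
  also have "\<dots> \<le> (\<Sum>j<r. (?A ^\<^sub>m l) $$ (i, j) * \<theta> ^ (r - 1 - j))"
    using j nonneg \<open>0 < \<theta>\<close> by (intro member_le_sum) auto
  also have "\<dots> \<le> \<theta> ^ l * \<theta> ^ (r - 1 - i)" by (rule bound)
  also have "\<dots> \<le> \<theta> ^ l"
    using \<open>0 < \<theta>\<close> \<open>\<theta> \<le> 1\<close> by (simp add: mult_left_le power_le_one)
  finally show ?thesis
    using nonneg[OF j, of l] \<open>0 < \<theta>\<close> by (simp add: field_simps)
qed

lemma companion_contraction_rate:
  fixes c :: "nat \<Rightarrow> real"
  assumes "r > 0" and c: "\<And>k. 1 \<le> k \<Longrightarrow> k \<le> r \<Longrightarrow> 0 \<le> c k" and m: "(\<Sum>k = 1..r. c k) < 1"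
  obtains \<theta> where "0 < \<theta>" "\<theta> < 1" "(\<Sum>k = 1..r. c k * \<theta> ^ (r - k)) \<le> \<theta> ^ r"
proof -
  \<comment> \<open>The midpoint of the sum and 1 is positive even if the sum is 0. With \<theta>
    its r-th root, the powers of \<theta> on the left are at most 1, so the left side is at most the
    sum, hence at most \<theta>^r.\<close>
  define a where "a = (1 + (\<Sum>k = 1..r. c k)) / 2"
  have "0 \<le> (\<Sum>k = 1..r. c k)" using c by (intro sum_nonneg) auto
  then have a: "0 < a" "a < 1" "(\<Sum>k = 1..r. c k) \<le> a"
    using m by (auto simp: a_def)
  define \<theta> where "\<theta> = root r a"
  have \<theta>: "0 < \<theta>" "\<theta> < 1" "\<theta> ^ r = a"
    using a \<open>r > 0\<close> by (auto simp: \<theta>_def)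
  have "(\<Sum>k = 1..r. c k * \<theta> ^ (r - k)) \<le> (\<Sum>k = 1..r. c k)"
    using c \<theta> by (intro sum_mono mult_left_le) (auto intro: power_le_one)
  then show thesis using \<theta> a that by simp
qed

lemma summable_norm_companion_pow:
  fixes c :: "nat \<Rightarrow> real"
  assumes N: "multiplicative_norm r N" and "r > 0"
    and c: "\<And>k. 1 \<le> k \<Longrightarrow> k \<le> r \<Longrightarrow> 0 \<le> c k" and m: "(\<Sum>k = 1..r. c k) < 1"
  shows "summable (\<lambda>l. N (companion r c ^\<^sub>m l))"
proof -
  obtain \<theta> where \<theta>: "0 < \<theta>" "\<theta> < 1" "(\<Sum>k = 1..r. c k * \<theta> ^ (r - k)) \<le> \<theta> ^ r"
    using companion_contraction_rate[OF \<open>r > 0\<close> c m] by blast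
  define e where "e k = N (Matrix.mat r r (\<lambda>ij. of_bool (ij = k)))" for k :: "nat \<times> nat"
  have e: "0 \<le> e k" for k
    using N by (simp add: e_def multiplicative_norm_def)
  have nonneg: "0 \<le> N (companion r c ^\<^sub>m l)" for l
    using N by (simp add: multiplicative_norm_def)
  define K where "K = (\<Sum>(i, j) \<in> {..<r} \<times> {..<r}. e (i, j)) / \<theta> ^ (r - 1)"
  have "N (companion r c ^\<^sub>m l) \<le> K * \<theta> ^ l" for l
  proof -
    have "N (companion r c ^\<^sub>m l) \<le>
        (\<Sum>(i, j) \<in> {..<r} \<times> {..<r}. \<bar>(companion r c ^\<^sub>m l) $$ (i, j)\<bar> * e (i, j))"
      using multiplicative_norm_le_entries[OF N companion_pow_carrier] by (simp add: e_def)
    also have "\<dots> \<le> (\<Sum>(i, j) \<in> {..<r} \<times> {..<r}. \<theta> ^ l / \<theta> ^ (r - 1) * e (i, j))"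
    proof (intro sum_mono, clarify)
      fix i j assume "i < r" "j < r"
      then show "\<bar>(companion r c ^\<^sub>m l) $$ (i, j)\<bar> * e (i, j) \<le> \<theta> ^ l / \<theta> ^ (r - 1) * e (i, j)"
        using c \<theta> e by (intro mult_right_mono companion_pow_entry_le) auto
    qed
    also have "\<dots> = K * \<theta> ^ l"
      unfolding K_def case_prod_unfold sum_divide_distrib sum_distrib_right by (simp add: mult_ac)
    finally show ?thesis .
  qed
  then have bound: "norm (N (companion r c ^\<^sub>m l)) \<le> K * \<theta> ^ l" for l
    using nonneg by simp
  have "summable (\<lambda>l. K * \<theta> ^ l)"
    using \<theta> by (intro summable_mult) (simp add: summable_geometric)
  then show ?thesis
    using bound by (rule summable_comparison_test')
qed

text \<open>Termwise m^l \<le> x^l \<le> N (A^l) for a characteristic root x \<ge> m, m being the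
  sum of the weights. This compares the norm-dependent \<lambda> with a / (1 - m), which is free of
  the norm.\<close>

lemma suminf_norm_companion_pow_ge:
  fixes c :: "nat \<Rightarrow> real"
  assumes N: "multiplicative_norm r N" and "r > 0"
    and c: "\<And>k. 1 \<le> k \<Longrightarrow> k \<le> r \<Longrightarrow> 0 \<le> c k" and m: "(\<Sum>k = 1..r. c k) < 1"
  shows "1 / (1 - (\<Sum>k = 1..r. c k)) \<le> (\<Sum>l. N (companion r c ^\<^sub>m l))"
proof -
  let ?m = "\<Sum>k = 1..r. c k"
  have m0: "0 \<le> ?m" using c by (intro sum_nonneg) auto
  obtain x where x: "?m \<le> x" "(\<Sum>k = 1..r. c k * x ^ (r - k)) = x ^ r"
  proof (rule companion_char_root[of r c])
    fix x assume "?m \<le> 1 \<Longrightarrow> ?m \<le> x" "(\<Sum>k = 1..r. c k * x ^ (r - k)) = x ^ r"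
    then show thesis using m by (intro that[of x]) simp_all
  qed (use \<open>r > 0\<close> c in auto)
  have "?m ^ l \<le> N (companion r c ^\<^sub>m l)" for l
    using power_mono[OF x(1) m0, of l]
      multiplicative_norm_companion_pow_ge[OF N \<open>r > 0\<close> x(2), of l] m0 x(1) by simp
  then have "(\<Sum>l. ?m ^ l) \<le> (\<Sum>l. N (companion r c ^\<^sub>m l))"
    using m m0 summable_norm_companion_pow[OF N \<open>r > 0\<close> c m]
    by (intro suminf_le summable_geometric) auto
  then show ?thesis using m m0 suminf_geometric[of ?m] by simp
qed

section \<open>Linear recursive inequalities\<close>

text \<open>Order r is reduced to order one by bounding the last r values together, with weight
  \<theta>^i on the value i steps back; the common bound obeys R (n+1) = \<theta> R n + V.\<close>

lemma recursive_inequality_bound: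
  fixes U V :: "int \<Rightarrow> real" and c :: "nat \<Rightarrow> real"
  assumes "r > 0" and c: "\<And>k. 1 \<le> k \<Longrightarrow> k \<le> r \<Longrightarrow> 0 \<le> c k"
    and \<theta>: "0 < \<theta>" "\<theta> \<le> 1" and sub: "(\<Sum>k = 1..r. c k * \<theta> ^ (r - k)) \<le> \<theta> ^ r"
    and U: "\<And>t. 0 \<le> U t" and V: "\<And>t. 0 \<le> V t"
    and rec: "\<And>t. U t \<le> (\<Sum>k = 1..r. c k * U (t - int k)) + V t"
  shows "U (t + int n) \<le> \<theta> ^ n * (\<Sum>i<r. U (t - int i)) + (\<Sum>l<n. \<theta> ^ l * V (t + int n - int l))"
proof -
  define R where "R n = \<theta> ^ n * (\<Sum>i<r. U (t - int i)) + (\<Sum>l<n. \<theta> ^ l * V (t + int n - int l))" for n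
  have R0: "0 \<le> R n" for n
    unfolding R_def using U V \<theta> by (intro add_nonneg_nonneg mult_nonneg_nonneg sum_nonneg) auto
  have RSuc: "R (Suc n) = \<theta> * R n + V (t + int (Suc n))" for n
    by (simp add: R_def sum.lessThan_Suc_shift algebra_simps sum_distrib_left del: sum.lessThan_Suc)
  \<comment> \<open>The hypothesis on \<theta> divided by \<theta>^(r-1): lag k is position k - 1 of
    the previous window, hence the exponent k - 1.\<close>
  have csum: "(\<Sum>k = 1..r. c k / \<theta> ^ (k - 1)) \<le> \<theta>"
  proof -
    have "(\<Sum>k = 1..r. c k / \<theta> ^ (k - 1)) = (\<Sum>k = 1..r. c k * \<theta> ^ (r - k)) / \<theta> ^ (r - 1)"
      unfolding sum_divide_distrib
    proof (intro sum.cong refl)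
      fix k assume "k \<in> {1..r}"
      then have "\<theta> ^ (r - 1) = \<theta> ^ (k - 1) * \<theta> ^ (r - k)"
        unfolding power_add[symmetric] by simp
      then show "c k / \<theta> ^ (k - 1) = c k * \<theta> ^ (r - k) / \<theta> ^ (r - 1)"
        using \<theta> by simp
    qed
    also have "\<dots> \<le> \<theta> ^ r / \<theta> ^ (r - 1)"
      using sub \<theta> by (intro divide_right_mono) auto
    also have "\<dots> = \<theta>"
      using \<open>r > 0\<close> \<theta> by (cases r) auto
    finally show ?thesis .
  qed
  \<comment> \<open>Position 0 uses the recursion; position j + 1 is position j of the previous
    window and gains one factor \<theta>.\<close>
  have "\<forall>i<r. \<theta> ^ i * U (t + int n - int i) \<le> R n"
  proof (induction n)
    case 0
    have "\<theta> ^ i * U (t - int i) \<le> (\<Sum>i<r. U (t - int i))" if "i < r" for i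
    proof -
      have "\<theta> ^ i * U (t - int i) \<le> U (t - int i)"
        using \<theta> U by (intro mult_left_le_one_le) (auto intro: power_le_one)
      also have "\<dots> \<le> (\<Sum>i<r. U (t - int i))"
        using that U by (intro member_le_sum) auto
      finally show ?thesis .
    qed
    then show ?case by (simp add: R_def)
  next
    case (Suc n)
    show ?case
    proof (intro allI impI)
      fix i assume i: "i < r"
      show "\<theta> ^ i * U (t + int (Suc n) - int i) \<le> R (Suc n)"
      proof (cases i)
        case 0
        have "U (t + int (Suc n)) \<le> (\<Sum>k = 1..r. c k * U (t + int (Suc n) - int k)) + V (t + int (Suc n))"
          by (rule rec)
        also have "(\<Sum>k = 1..r. c k * U (t + int (Suc n) - int k)) \<le> (\<Sum>k = 1..r. c k * (R n / \<theta> ^ (k - 1)))"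
        proof (intro sum_mono mult_left_mono)
          fix k assume k: "k \<in> {1..r}"
          then have "k - 1 < r" "t + int n - int (k - 1) = t + int (Suc n) - int k"
            by auto
          then have "\<theta> ^ (k - 1) * U (t + int (Suc n) - int k) \<le> R n"
            using Suc.IH by metis
          then show "U (t + int (Suc n) - int k) \<le> R n / \<theta> ^ (k - 1)"
            using \<theta> by (simp only: pos_le_divide_eq zero_less_power mult.commute)
        qed (use c in auto)
        also have "\<dots> = (\<Sum>k = 1..r. c k / \<theta> ^ (k - 1)) * R n"
          by (simp add: sum_distrib_right)
        also have "\<dots> \<le> \<theta> * R n"
          using csum R0 by (rule mult_right_mono)
        finally show ?thesis using 0 by (simp add: RSuc)
      next
        case (Suc j)
        then have "t + int (Suc n) - int i = t + int n - int j" by simp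
        then have "\<theta> ^ i * U (t + int (Suc n) - int i) = \<theta> * (\<theta> ^ j * U (t + int n - int j))"
          by (simp only: Suc power_Suc mult.assoc)
        also have "\<dots> \<le> \<theta> * R n"
          using Suc.IH i Suc \<theta> by (intro mult_left_mono) auto
        also have "\<dots> \<le> R (Suc n)" using V by (simp add: RSuc)
        finally show ?thesis .
      qed
    qed
  qed
  then show ?thesis using \<open>r > 0\<close> by (auto simp: R_def)
qed

text \<open>Jensen's inequality for \<open>exp\<close>, with the additive term \<open>y\<close> carrying the missing weight
  \<open>1 - \<Sum> c\<close>.\<close>

lemma exp_subconvex_combination:
  fixes c x :: "'i \<Rightarrow> real"
  assumes c: "\<And>k. k \<in> I \<Longrightarrow> 0 \<le> c k" and m: "sum c I < 1" and "0 < s"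
    and L: "L \<le> (\<Sum>k\<in>I. c k * x k) + y"
  shows "exp (s * L) \<le> (\<Sum>k\<in>I. c k * exp (s * x k)) + (1 - sum c I) * exp (s * (y / (1 - sum c I)))"
proof -
  define a where "a = s * ((\<Sum>k\<in>I. c k * x k) + y)"
  \<comment> \<open>Supporting line of exp at a. The points s x_k and s y / (1 - \<Sum> c), with
    weights c_k and 1 - \<Sum> c, have mean a, so averaging the lines gives exactly exp a.\<close>
  have tangent: "exp a * (1 + (z - a)) \<le> exp z" for z
    using mult_left_mono[OF exp_ge_add_one_self[of "z - a"], of "exp a"]
    by (simp add: exp_diff)
  have "(\<Sum>k\<in>I. c k * (1 + (s * x k - a))) + (1 - sum c I) * (1 + (s * (y / (1 - sum c I)) - a)) =
      1 - a + s * (\<Sum>k\<in>I. c k * x k) + s * y"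
    using m by (simp add: sum.distrib sum_subtractf sum_distrib_left sum_distrib_right field_simps)
  also have "\<dots> = 1"
    by (simp add: a_def distrib_left)
  finally have "exp a = exp a * ((\<Sum>k\<in>I. c k * (1 + (s * x k - a))) +
      (1 - sum c I) * (1 + (s * (y / (1 - sum c I)) - a)))"
    by (simp only: mult_1_right)
  also have "\<dots> = (\<Sum>k\<in>I. c k * (exp a * (1 + (s * x k - a)))) +
      (1 - sum c I) * (exp a * (1 + (s * (y / (1 - sum c I)) - a)))"
    unfolding distrib_left[of "exp a" "sum _ _"] sum_distrib_left by (simp add: mult_ac)
  also have "\<dots> \<le> (\<Sum>k\<in>I. c k * exp (s * x k)) + (1 - sum c I) * exp (s * (y / (1 - sum c I)))"
    using c m by (intro add_mono sum_mono mult_left_mono tangent) auto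
  finally have "exp a \<le> \<dots>" .
  moreover have "s * L \<le> a"
    using L \<open>0 < s\<close> by (simp add: a_def)
  ultimately show ?thesis by (meson exp_le_cancel_iff order_trans)
qed

section \<open>Stationary sequences and essential suprema\<close>

lemma (in prob_space) nn_integral_identically_distributed:
  assumes "X \<in> borel_measurable M" "Y \<in> borel_measurable M"
    and "distr M borel X = distr M borel Y" and "f \<in> borel_measurable borel"
  shows "(\<integral>\<^sup>+ w. f (X w) \<partial>M) = (\<integral>\<^sup>+ w. f (Y w) \<partial>M)"
  using nn_integral_distr[OF assms(1), of f] nn_integral_distr[OF assms(2), of f] assms(3,4) by simp

text \<open>The remainder \<open>\<theta>\<^sup>n \<Sum> U\<close> tends to \<open>0\<close> in probability because all \<open>U t\<close> have the same law;
  no moment of \<open>U\<close> is needed.\<close>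

lemma (in prob_space) AE_le_of_geometric_remainder:
  fixes U :: "int \<Rightarrow> 'a \<Rightarrow> real"
  assumes meas [measurable]: "\<And>t. U t \<in> borel_measurable M" "Z \<in> borel_measurable M"
    and law: "\<And>t. distr M borel (U t) = distr M borel (U 0)"
    and U: "\<And>t w. 0 \<le> U t w" and \<theta>: "0 < \<theta>" "\<theta> < 1"
    and bound: "\<And>n. AE w in M. ennreal (U 0 w) \<le> ennreal (\<theta> ^ n * (\<Sum>i<r. U (- int n - int i) w)) + Z w"
  shows "AE w in M. ennreal (U 0 w) \<le> Z w"
proof -
  \<comment> \<open>Truncation at 1 provides an integrable dominating constant, whatever the tails
    of \<open>U 0\<close>.\<close>
  define h where "h n = (\<integral>\<^sup>+ w. min 1 (ennreal (\<theta> ^ n * U 0 w)) \<partial>M)" for n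
  have "h \<longlonglongrightarrow> (\<integral>\<^sup>+ w. 0 \<partial>M)"
    unfolding h_def
  proof (rule nn_integral_dominated_convergence[where w = "\<lambda>_. 1"])
    show "AE w in M. (\<lambda>n. min 1 (ennreal (\<theta> ^ n * U 0 w))) \<longlonglongrightarrow> 0"
    proof (intro AE_I2)
      fix w
      have "(\<lambda>n. \<theta> ^ n * U 0 w) \<longlonglongrightarrow> 0"
        using \<theta> by (intro tendsto_mult_left_zero LIMSEQ_power_zero) simp
      then have "(\<lambda>n. min 1 (ennreal (\<theta> ^ n * U 0 w))) \<longlonglongrightarrow> min 1 (ennreal 0)"
        by (intro tendsto_min tendsto_const tendsto_ennrealI)
      then show "(\<lambda>n. min 1 (ennreal (\<theta> ^ n * U 0 w))) \<longlonglongrightarrow> 0" by simp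
    qed
  qed (auto simp: emeasure_space_1)
  then have "(\<lambda>n. of_nat r * h n) \<longlonglongrightarrow> of_nat r * 0"
    by (intro ennreal_tendsto_cmult) (auto simp: of_nat_less_top)
  \<comment> \<open>The truncated excess of \<open>U 0\<close> over \<open>Z\<close> is independent
    of n, yet at most r times h n: min 1 is subadditive and all \<open>U t\<close> share one
    law.\<close>
  moreover have "(\<integral>\<^sup>+ w. min 1 (ennreal (U 0 w) - Z w) \<partial>M) \<le> of_nat r * h n" for n
  proof -
    have "(\<integral>\<^sup>+ w. min 1 (ennreal (U 0 w) - Z w) \<partial>M) \<le>
        (\<integral>\<^sup>+ w. (\<Sum>i<r. min 1 (ennreal (\<theta> ^ n * U (- int n - int i) w))) \<partial>M)"
    proof (rule nn_integral_mono_AE, use bound[of n] in eventually_elim)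
      fix w assume *: "ennreal (U 0 w) \<le> ennreal (\<theta> ^ n * (\<Sum>i<r. U (- int n - int i) w)) + Z w"
      have subadd: "min 1 (\<Sum>i\<in>I. a i) \<le> (\<Sum>i\<in>I. min 1 (a i))" if "finite I" for I :: "nat set" and a :: "nat \<Rightarrow> ennreal"
        using that
      proof (induction I)
        case (insert i I)
        have "min 1 (a i + sum a I) \<le> min 1 (a i) + min 1 (sum a I)"
          by (auto simp: min_def add_increasing add_increasing2)
        also have "\<dots> \<le> min 1 (a i) + (\<Sum>i\<in>I. min 1 (a i))"
          using insert.IH by (rule add_left_mono)
        finally show ?case using insert by simp
      qed simp
      have "ennreal (U 0 w) - Z w \<le> ennreal (\<theta> ^ n * (\<Sum>i<r. U (- int n - int i) w))"
        using * by (simp add: ennreal_minus_le_iff add.commute)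
      also have "\<dots> = (\<Sum>i<r. ennreal (\<theta> ^ n * U (- int n - int i) w))"
        using \<theta> U by (simp add: sum_distrib_left sum_ennreal)
      finally have "min 1 (ennreal (U 0 w) - Z w) \<le> min 1 (\<Sum>i<r. ennreal (\<theta> ^ n * U (- int n - int i) w))"
        by (rule min.mono[OF order_refl])
      also have "\<dots> \<le> (\<Sum>i<r. min 1 (ennreal (\<theta> ^ n * U (- int n - int i) w)))"
        by (rule subadd) simp
      finally show "min 1 (ennreal (U 0 w) - Z w) \<le> (\<Sum>i<r. min 1 (ennreal (\<theta> ^ n * U (- int n - int i) w)))" .
    qed
    also have "\<dots> = (\<Sum>i<r. \<integral>\<^sup>+ w. min 1 (ennreal (\<theta> ^ n * U (- int n - int i) w)) \<partial>M)"
      by (rule nn_integral_sum) measurable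
    also have "\<dots> = (\<Sum>i<r. h n)"
      unfolding h_def
      by (intro sum.cong refl nn_integral_identically_distributed[where f = "\<lambda>x. min 1 (ennreal (\<theta> ^ n * x))"] law)
        measurable
    finally show ?thesis by simp
  qed
  ultimately have "(\<integral>\<^sup>+ w. min 1 (ennreal (U 0 w) - Z w) \<partial>M) \<le> 0"
    by (intro LIMSEQ_le_const) auto
  then have "AE w in M. min 1 (ennreal (U 0 w) - Z w) = 0"
    by (subst (asm) le_zero_eq, subst (asm) nn_integral_0_iff_AE) auto
  then show ?thesis
  proof eventually_elim
    fix w assume "min 1 (ennreal (U 0 w) - Z w) = 0"
    then have "ennreal (U 0 w) - Z w = 0" by (auto simp: min_def split: if_splits)
    then show "ennreal (U 0 w) \<le> Z w" by (auto simp: diff_eq_0_iff_ennreal)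
  qed
qed

text \<open>\<open>real_of_ereal\<close> sends infinite values to 0, so finiteness comes first: from
  above by B, from below by a point at which the almost sure bound holds.\<close>

lemma (in prob_space) AE_abs_le_real_esssup:
  fixes X :: "'a \<Rightarrow> real"
  assumes [measurable]: "X \<in> borel_measurable M" and B: "AE w in M. \<bar>X w\<bar> \<le> B"
  shows "AE w in M. \<bar>X w\<bar> \<le> real_of_ereal (esssup M (\<lambda>w. ereal \<bar>X w\<bar>))"
proof -
  let ?e = "esssup M (\<lambda>w. ereal \<bar>X w\<bar>)"
  have AE: "AE w in M. ereal \<bar>X w\<bar> \<le> ?e" by (rule esssup_AE)
  have "?e \<le> ereal B" using B by (intro esssup_I) auto
  moreover have "0 \<le> ?e"
  proof -
    obtain w where "ereal \<bar>X w\<bar> \<le> ?e"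
      using eventually_happens'[OF ae_filter_bot AE] by blast
    then show ?thesis by (rule order_trans[rotated]) simp
  qed
  ultimately have "ereal (real_of_ereal ?e) = ?e"
    by (intro ereal_real') auto
  then show ?thesis using AE by (metis (mono_tags, lifting) ereal_less_eq(3) AE_mp AE_I2)
qed

section \<open>The log-GARCH recursion\<close>

text \<open>Zero padding beyond q and p merges two sums of different lengths into one.\<close>

lemma sum_mu:
  "(\<Sum>i = 1..max p q. mu p q ap am b i (x i) * y i) =
   (\<Sum>i = 1..q. (ap i * of_bool (x i > 0) + am i * of_bool (x i < 0)) * y i) + (\<Sum>j = 1..p. b j * y j)"
proof -
  have trunc: "(\<Sum>i = 1..max p q. (if i \<le> n then f i else 0) * y i) = (\<Sum>i = 1..n. f i * y i)"
    if "n \<le> max p q" for n and f :: "nat \<Rightarrow> real"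
    using that by (intro sum.mono_neutral_cong_right) auto
  have "(\<Sum>i = 1..max p q. mu p q ap am b i (x i) * y i) =
      (\<Sum>i = 1..max p q. (if i \<le> q then ap i * of_bool (x i > 0) + am i * of_bool (x i < 0) else 0) * y i) +
      (\<Sum>i = 1..max p q. (if i \<le> p then b i else 0) * y i)"
    by (simp only: mu_def distrib_right sum.distrib)
  then show ?thesis by (simp only: trunc max.cobounded1 max.cobounded2)
qed

text \<open>As \<sigma> > 0, \<epsilon> has the sign of \<eta>, and for \<eta> \<noteq> 0 the
  logarithm of \<epsilon>^2 splits into those of \<sigma>^2 and \<eta>^2: the first joins the
  \<beta> terms in \<open>mu\<close>, the second is noise. At \<eta> = 0 both indicators
  vanish.\<close>

lemma log_garch_abs_ln_volatility_le:
  fixes \<epsilon> \<sigma> \<eta> :: "int \<Rightarrow> real"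
  assumes pos: "\<And>t. 0 < \<sigma> t" and \<epsilon>: "\<And>t. \<epsilon> t = \<sigma> t * \<eta> t"
    and rec: "ln ((\<sigma> t)\<^sup>2) = \<omega>
          + (\<Sum>i = 1..q. (ap i * of_bool (\<epsilon> (t - int i) > 0) +
                         am i * of_bool (\<epsilon> (t - int i) < 0)) * ln ((\<epsilon> (t - int i))\<^sup>2))
          + (\<Sum>j = 1..p. b j * ln ((\<sigma> (t - int j))\<^sup>2))"
    and mu: "\<And>i. 1 \<le> i \<Longrightarrow> i \<le> max p q \<Longrightarrow> \<bar>mu p q ap am b i (\<eta> (t - int i))\<bar> \<le> c i"
    and a: "\<And>i. 1 \<le> i \<Longrightarrow> i \<le> q \<Longrightarrow> \<bar>ap i\<bar> \<le> a \<and> \<bar>am i\<bar> \<le> a"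
  shows "\<bar>ln ((\<sigma> t)\<^sup>2)\<bar> \<le> (\<Sum>i = 1..max p q. c i * \<bar>ln ((\<sigma> (t - int i))\<^sup>2)\<bar>) +
    (\<bar>\<omega>\<bar> + a * (\<Sum>i = 1..q. \<bar>ln ((\<eta> (t - int i))\<^sup>2)\<bar>))"
proof -
  define \<alpha> where "\<alpha> i = ap i * of_bool (\<eta> (t - int i) > 0) + am i * of_bool (\<eta> (t - int i) < 0)" for i
  have \<alpha>: "(ap i * of_bool (\<epsilon> (t - int i) > 0) + am i * of_bool (\<epsilon> (t - int i) < 0)) * ln ((\<epsilon> (t - int i))\<^sup>2) =
      \<alpha> i * ln ((\<sigma> (t - int i))\<^sup>2) + \<alpha> i * ln ((\<eta> (t - int i))\<^sup>2)" for i
  proof (cases "\<eta> (t - int i) = 0")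
    case False
    then show ?thesis
      using pos[of "t - int i"]
      by (simp add: \<alpha>_def \<epsilon> power_mult_distrib ln_mult zero_less_mult_iff mult_less_0_iff distrib_left)
  qed (simp add: \<alpha>_def \<epsilon>)
  have \<alpha>a: "\<bar>\<alpha> i\<bar> \<le> a" if "1 \<le> i" "i \<le> q" for i
    using a[OF that] by (auto simp: \<alpha>_def)
  have decomp: "ln ((\<sigma> t)\<^sup>2) = (\<Sum>i = 1..max p q. mu p q ap am b i (\<eta> (t - int i)) * ln ((\<sigma> (t - int i))\<^sup>2)) +
      (\<omega> + (\<Sum>i = 1..q. \<alpha> i * ln ((\<eta> (t - int i))\<^sup>2)))"
    unfolding rec \<alpha> sum_mu sum.distrib by (simp add: \<alpha>_def)
  have "\<bar>ln ((\<sigma> t)\<^sup>2)\<bar> \<le> (\<Sum>i = 1..max p q. \<bar>mu p q ap am b i (\<eta> (t - int i)) * ln ((\<sigma> (t - int i))\<^sup>2)\<bar>) +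
      (\<bar>\<omega>\<bar> + (\<Sum>i = 1..q. \<bar>\<alpha> i * ln ((\<eta> (t - int i))\<^sup>2)\<bar>))"
    unfolding decomp by (intro order_trans[OF abs_triangle_ineq] add_mono order_refl sum_abs)
  also have "\<dots> \<le> (\<Sum>i = 1..max p q. c i * \<bar>ln ((\<sigma> (t - int i))\<^sup>2)\<bar>) +
      (\<bar>\<omega>\<bar> + (\<Sum>i = 1..q. a * \<bar>ln ((\<eta> (t - int i))\<^sup>2)\<bar>))"
    unfolding abs_mult using mu \<alpha>a by (intro add_mono sum_mono mult_right_mono order_refl) auto
  finally show ?thesis by (simp add: sum_distrib_left)
qed

text \<open>By convexity the weight \<open>1 - \<Sum> c\<close> turns into the exponent \<open>s a / (1 - \<Sum> c)\<close> of the
  innovations; this is where \<open>\<lambda> \<ge> a / (1 - \<Sum> c)\<close> enters.\<close>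

lemma log_garch_exp_volatility_le:
  fixes \<epsilon> \<sigma> \<eta> :: "int \<Rightarrow> real"
  assumes "\<And>t. 0 < \<sigma> t" and "\<And>t. \<epsilon> t = \<sigma> t * \<eta> t"
    and "ln ((\<sigma> t)\<^sup>2) = \<omega>
          + (\<Sum>i = 1..q. (ap i * of_bool (\<epsilon> (t - int i) > 0) +
                         am i * of_bool (\<epsilon> (t - int i) < 0)) * ln ((\<epsilon> (t - int i))\<^sup>2))
          + (\<Sum>j = 1..p. b j * ln ((\<sigma> (t - int j))\<^sup>2))"
    and mu: "\<And>i. 1 \<le> i \<Longrightarrow> i \<le> max p q \<Longrightarrow> \<bar>mu p q ap am b i (\<eta> (t - int i))\<bar> \<le> c i"
    and "\<And>i. 1 \<le> i \<Longrightarrow> i \<le> q \<Longrightarrow> \<bar>ap i\<bar> \<le> a \<and> \<bar>am i\<bar> \<le> a"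
    and m: "(\<Sum>k = 1..max p q. c k) < 1" and "0 < s"
    and \<Lambda>: "a / (1 - (\<Sum>k = 1..max p q. c k)) \<le> \<Lambda>"
  shows "exp (s * \<bar>ln ((\<sigma> t)\<^sup>2)\<bar>) \<le> (\<Sum>k = 1..max p q. c k * exp (s * \<bar>ln ((\<sigma> (t - int k))\<^sup>2)\<bar>)) +
    exp (s * (\<bar>\<omega>\<bar> / (1 - (\<Sum>k = 1..max p q. c k)))) *
      (\<Prod>i = 1..q. exp (s * \<Lambda> * \<bar>ln ((\<eta> (t - int i))\<^sup>2)\<bar>))"
proof -
  let ?m = "\<Sum>k = 1..max p q. c k"
  define S where "S = (\<Sum>i = 1..q. \<bar>ln ((\<eta> (t - int i))\<^sup>2)\<bar>)"
  have S: "0 \<le> S" by (simp add: S_def sum_nonneg)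
  have c: "0 \<le> c k" if "k \<in> {1..max p q}" for k
    using mu[of k] that by fastforce
  have "\<bar>ln ((\<sigma> t)\<^sup>2)\<bar> \<le> (\<Sum>i = 1..max p q. c i * \<bar>ln ((\<sigma> (t - int i))\<^sup>2)\<bar>) + (\<bar>\<omega>\<bar> + a * S)"
    unfolding S_def by (rule log_garch_abs_ln_volatility_le[OF assms(1-5)])
  from exp_subconvex_combination[OF c m \<open>0 < s\<close> this]
  have "exp (s * \<bar>ln ((\<sigma> t)\<^sup>2)\<bar>) \<le> (\<Sum>k = 1..max p q. c k * exp (s * \<bar>ln ((\<sigma> (t - int k))\<^sup>2)\<bar>)) +
      (1 - ?m) * exp (s * ((\<bar>\<omega>\<bar> + a * S) / (1 - ?m)))"
    by simp
  \<comment> \<open>The factor 1 - m is at most 1 and is dropped; in the exponent a / (1 - m) is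
    then enlarged to \<Lambda>.\<close>
  also have "(1 - ?m) * exp (s * ((\<bar>\<omega>\<bar> + a * S) / (1 - ?m))) \<le> exp (s * ((\<bar>\<omega>\<bar> + a * S) / (1 - ?m)))"
    using m c by (intro mult_left_le_one_le) (auto intro: sum_nonneg)
  also have "\<dots> \<le> exp (s * (\<bar>\<omega>\<bar> / (1 - ?m)) + s * \<Lambda> * S)"
    using mult_left_mono[OF mult_right_mono[OF \<Lambda> S], of s] \<open>0 < s\<close>
    by (simp add: add_divide_distrib distrib_left mult.assoc)
  also have "exp (s * (\<bar>\<omega>\<bar> / (1 - ?m)) + s * \<Lambda> * S) = exp (s * (\<bar>\<omega>\<bar> / (1 - ?m))) *
      (\<Prod>i = 1..q. exp (s * \<Lambda> * \<bar>ln ((\<eta> (t - int i))\<^sup>2)\<bar>))"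
    by (simp add: exp_add S_def sum_distrib_left exp_sum)
  finally show ?thesis by simp
qed

lemma (in prob_space) nn_integral_prod_iid:
  assumes "iid_process M \<eta>" and [measurable]: "f \<in> borel_measurable borel" and "finite I"
  shows "(\<integral>\<^sup>+ w. (\<Prod>i\<in>I. f (\<eta> i w)) \<partial>M) = (\<integral>\<^sup>+ w. f (\<eta> 0 w) \<partial>M) ^ card I"
proof -
  have indep: "indep_vars (\<lambda>_. borel) \<eta> UNIV" and law: "\<And>t. distr M borel (\<eta> t) = distr M borel (\<eta> 0)"
    using assms(1) by (auto simp: iid_process_def)
  have meas: "\<eta> t \<in> borel_measurable M" for t
    using indep by (auto simp: indep_vars_def)
  have "indep_vars (\<lambda>_. borel) (\<lambda>i w. f (\<eta> i w)) I"
    by (rule indep_vars_compose2[OF indep_vars_subset[OF indep]]) auto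
  then have "(\<integral>\<^sup>+ w. (\<Prod>i\<in>I. f (\<eta> i w)) \<partial>M) = (\<Prod>i\<in>I. \<integral>\<^sup>+ w. f (\<eta> i w) \<partial>M)"
    by (intro indep_vars_nn_integral \<open>finite I\<close>) auto
  also have "\<dots> = (\<Prod>i\<in>I. \<integral>\<^sup>+ w. f (\<eta> 0 w) \<partial>M)"
    by (intro prod.cong refl nn_integral_identically_distributed meas law) measurable
  finally show ?thesis by simp
qed

text \<open>Time 1 - i is the one at which column i of the matrix \<open>A_mat\<close> at time 1
  reads the innovation.\<close>

definition first_row_bound ::
    "'a measure \<Rightarrow> (int \<Rightarrow> 'a \<Rightarrow> real) \<Rightarrow> nat \<Rightarrow> nat \<Rightarrow>
     (nat \<Rightarrow> real) \<Rightarrow> (nat \<Rightarrow> real) \<Rightarrow> (nat \<Rightarrow> real) \<Rightarrow> nat \<Rightarrow> real" where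
  "first_row_bound M \<eta> p q ap am b i =
     real_of_ereal (esssup M (\<lambda>w. ereal \<bar>mu p q ap am b i (\<eta> (1 - int i) w)\<bar>))"

text \<open>The lower rows are deterministic, and under a probability measure a constant is its own
  essential supremum.\<close>

lemma (in prob_space) A_inf_eq_companion:
  "A_inf M \<eta> p q ap am b = companion (max p q) (first_row_bound M \<eta> p q ap am b)"
  by (intro eq_matI)
     (auto simp: A_inf_def companion_def A_mat_def first_row_bound_def esssup_const emeasure_space_1)

text \<open>The essential supremum refers to time 1 - i; read as a statement about the law of the
  innovation, the bound passes to every t.\<close>

lemma (in prob_space) AE_mu_le_first_row_bound:
  assumes "iid_process M \<eta>"
  shows "AE w in M. \<bar>mu p q ap am b i (\<eta> t w)\<bar> \<le> first_row_bound M \<eta> p q ap am b i"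
proof -
  have [measurable]: "\<eta> t \<in> borel_measurable M" for t
    using assms by (auto simp: iid_process_def indep_vars_def)
  have [measurable]: "mu p q ap am b i \<in> borel_measurable borel"
    unfolding mu_def by measurable
  have "\<bar>mu p q ap am b i x\<bar> \<le> \<bar>ap i\<bar> + \<bar>am i\<bar> + \<bar>b i\<bar>" for x
    by (auto simp: mu_def)
  then have "AE w in M. \<bar>mu p q ap am b i (\<eta> (1 - int i) w)\<bar> \<le> first_row_bound M \<eta> p q ap am b i"
    unfolding first_row_bound_def by (intro AE_abs_le_real_esssup AE_I2) auto
  then have "AE x in distr M borel (\<eta> (1 - int i)). \<bar>mu p q ap am b i x\<bar> \<le> first_row_bound M \<eta> p q ap am b i"
    by (subst AE_distr_iff) auto
  also have "distr M borel (\<eta> (1 - int i)) = distr M borel (\<eta> t)"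
    using assms by (metis iid_process_def)
  finally show ?thesis
    by (subst (asm) AE_distr_iff) auto
qed

text \<open>The marginal at t is the image, under evaluation at 0, of the law of the path shifted by
  t.\<close>

lemma (in prob_space) strictly_stationary_marginal:
  assumes "strictly_stationary M X" and [measurable]: "\<And>t. X t \<in> borel_measurable M"
    and [measurable]: "f \<in> borel_measurable borel"
  shows "distr M borel (\<lambda>w. f (X t w)) = distr M borel (\<lambda>w. f (X 0 w))"
proof -
  have "distr M borel (\<lambda>w. f (X (0 + t) w)) =
      distr (distr M (Pi\<^sub>M UNIV (\<lambda>_. borel)) (\<lambda>w u. X (u + t) w)) borel (\<lambda>x. f (x 0))" for t
    by (subst distr_distr) (auto simp: comp_def intro!: measurable_PiM_single')
  from this[of t] this[of 0] show ?thesis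
    using assms(1) by (simp add: strictly_stationary_def)
qed

text \<open>\<open>N\<close> acts in size 2q + p in the Lyapunov exponent and in size max p q in
  \<lambda>, hence two norm hypotheses. Summability in the conclusion expresses \<lambda> <
  \<infinity>, which the total \<open>suminf\<close> cannot.\<close>

theorem proposition3p1:
  fixes M :: "'a measure"
    and \<eta> \<epsilon> \<sigma> :: "int \<Rightarrow> 'a \<Rightarrow> real"
    and p q :: nat
    and \<omega> s :: real
    and ap am b :: "nat \<Rightarrow> real"
    and N :: "real mat \<Rightarrow> real"
  assumes "prob_space M"
    and "iid_process M \<eta>"
    and "integrable M (\<eta> 0)" and "(\<integral>w. \<eta> 0 w \<partial>M) = 0"
    and "integrable M (\<lambda>w. (\<eta> 0 w)\<^sup>2)" and "(\<integral>w. (\<eta> 0 w)\<^sup>2 \<partial>M) = 1"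
    and "max p q \<ge> 1"
    and "multiplicative_norm (2 * q + p) N" and "multiplicative_norm (max p q) N"
    and "top_lyapunov M N (2 * q + p) (\<lambda>t w. C_mat p q ap am b (\<eta> (int t) w)) < 0"
    and "spectral_radius (map_mat complex_of_real (A_inf M \<eta> p q ap am b)) < 1"
    and "s > 0"
    and "(\<integral>\<^sup>+ w. eexp (ereal (s * max (lambda_const M \<eta> N p q ap am b) 1) * \<bar>elog ((\<eta> 0 w)\<^sup>2)\<bar>) \<partial>M) < \<infinity>"
    and "log_garch_solution M \<eta> p q \<omega> ap am b \<epsilon> \<sigma>"
    and "strictly_stationary M (\<lambda>t w. (\<epsilon> t w, \<sigma> t w))"
  shows "summable (\<lambda>l. N (A_inf M \<eta> p q ap am b ^\<^sub>m l)) \<and>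
         (\<integral>\<^sup>+ w. ennreal (\<bar>\<epsilon> 0 w\<bar> powr (2 * s)) \<partial>M) < \<infinity>"
proof -
  interpret prob_space M by fact
  note iid = \<open>iid_process M \<eta>\<close> and N = \<open>multiplicative_norm (max p q) N\<close>
  define r where "r = max p q"
  define c where "c = first_row_bound M \<eta> p q ap am b"
  define m where "m = (\<Sum>k = 1..r. c k)"
  define \<Lambda> where "\<Lambda> = max (lambda_const M \<eta> N p q ap am b) 1"
  define a where "a = Max (insert 0 ((\<lambda>i. max \<bar>ap i\<bar> \<bar>am i\<bar>) ` {1..q}))"
  define g where "g x = exp (s * \<Lambda> * \<bar>ln (x\<^sup>2)\<bar>)" for x :: real
  define D where "D = exp (s * (\<bar>\<omega>\<bar> / (1 - m)))"
  define U where "U t w = exp (s * \<bar>ln ((\<sigma> t w)\<^sup>2)\<bar>)" for t w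
  define V where "V t w = D * (\<Prod>i = 1..q. g (\<eta> (t - int i) w))" for t w

  have \<eta>_meas [measurable]: "\<eta> t \<in> borel_measurable M" for t
    using iid by (auto simp: iid_process_def indep_vars_def)
  have [measurable]: "\<epsilon> t \<in> borel_measurable M" "\<sigma> t \<in> borel_measurable M" for t
    using assms(14) by (auto simp: log_garch_solution_def)
  have [measurable]: "g \<in> borel_measurable borel"
    unfolding g_def by measurable
  have [measurable]: "U t \<in> borel_measurable M" "V t \<in> borel_measurable M" for t
    unfolding U_def V_def by measurable
  have g0: "0 \<le> g x" for x by (simp add: g_def)
  have U0: "0 \<le> U t w" and V0: "0 \<le> V t w" for t w
    by (simp_all add: U_def V_def D_def g0 prod_nonneg)

  \<comment> \<open>Weights, the constant \<Lambda> and the contraction rate\<close>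
  have r: "r > 0" using assms(7) by (simp add: r_def)
  have A: "A_inf M \<eta> p q ap am b = companion r c"
    by (simp add: A_inf_eq_companion r_def c_def)
  have mu_le: "AE w in M. \<bar>mu p q ap am b i (\<eta> t w)\<bar> \<le> c i" for i t
    unfolding c_def by (rule AE_mu_le_first_row_bound[OF iid])
  have c: "0 \<le> c i" for i
    using eventually_happens'[OF ae_filter_bot mu_le[of i 0]] by force
  have m: "m < 1"
    unfolding m_def using companion_sum_less_1[OF r c] assms(11) A by simp
  have summable: "summable (\<lambda>l. N (companion r c ^\<^sub>m l))"
  proof (rule summable_norm_companion_pow)
    show "multiplicative_norm r N" "sum c {1..r} < 1"
      using N m by (simp_all only: r_def m_def)
  qed (rule r c)+
  have a: "\<bar>ap i\<bar> \<le> a \<and> \<bar>am i\<bar> \<le> a" if "1 \<le> i" "i \<le> q" for i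
  proof -
    have "max \<bar>ap i\<bar> \<bar>am i\<bar> \<le> a"
      unfolding a_def using that by (intro Max_ge) auto
    then show ?thesis by simp
  qed
  have "0 \<le> a" unfolding a_def by (intro Max_ge) auto
  have "1 / (1 - m) \<le> (\<Sum>l. N (companion r c ^\<^sub>m l))"
    unfolding m_def
  proof (rule suminf_norm_companion_pow_ge)
    show "multiplicative_norm r N" "sum c {1..r} < 1"
      using N m by (simp_all only: r_def m_def)
  qed (rule r c)+
  from mult_left_mono[OF this \<open>0 \<le> a\<close>]
  have \<Lambda>: "a / (1 - m) \<le> \<Lambda>" "1 \<le> \<Lambda>"
    by (simp_all add: \<Lambda>_def lambda_const_def A a_def)
  obtain \<theta> where \<theta>: "0 < \<theta>" "\<theta> < 1" "(\<Sum>k = 1..r. c k * \<theta> ^ (r - k)) \<le> \<theta> ^ r"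
    using companion_contraction_rate[of r c] r c m unfolding m_def by blast

  \<comment> \<open>Pathwise recursion and its iteration into the past\<close>
  have solution: "AE w in M. \<forall>t. \<sigma> t w > 0 \<and> \<epsilon> t w = \<sigma> t w * \<eta> t w \<and>
        ln ((\<sigma> t w)\<^sup>2) = \<omega>
          + (\<Sum>i = 1..q. (ap i * of_bool (\<epsilon> (t - int i) w > 0) +
                         am i * of_bool (\<epsilon> (t - int i) w < 0)) * ln ((\<epsilon> (t - int i) w)\<^sup>2))
          + (\<Sum>j = 1..p. b j * ln ((\<sigma> (t - int j) w)\<^sup>2))"
    using assms(14) by (subst AE_all_countable) (auto simp: log_garch_solution_def)
  \<comment> \<open>Times and lags are countable, so one null set serves all of them and the
    recursion can be iterated path by path.\<close>
  have "AE w in M. \<forall>i t. \<bar>mu p q ap am b i (\<eta> t w)\<bar> \<le> c i"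
    using mu_le by (simp add: AE_all_countable)
  with solution have rec: "AE w in M. \<forall>t. U t w \<le> (\<Sum>k = 1..r. c k * U (t - int k) w) + V t w"
  proof eventually_elim
    case (elim w)
    show ?case
    proof
      fix t
      show "U t w \<le> (\<Sum>k = 1..r. c k * U (t - int k) w) + V t w"
        unfolding U_def V_def D_def g_def m_def r_def
      proof (rule log_garch_exp_volatility_le[where \<sigma> = "\<lambda>t. \<sigma> t w" and \<epsilon> = "\<lambda>t. \<epsilon> t w" and \<eta> = "\<lambda>t. \<eta> t w"])
        show "0 < \<sigma> u w" "\<epsilon> u w = \<sigma> u w * \<eta> u w" for u
          using elim(1) by blast+
        show "\<bar>mu p q ap am b i (\<eta> (t - int i) w)\<bar> \<le> c i" for i
          using elim(2) by blast
        show "sum c {1..max p q} < 1" "a / (1 - sum c {1..max p q}) \<le> \<Lambda>"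
          using m \<Lambda> by (simp_all only: m_def r_def)
      qed (use elim(1) a assms(12) in blast)+
    qed
  qed
  \<comment> \<open>Summed in \<open>ennreal\<close>, so that \<open>Z\<close> makes sense before
    its finiteness is known.\<close>
  define Z where "Z w = (\<Sum>l. ennreal (\<theta> ^ l * V (- int l) w))" for w
  have [measurable]: "Z \<in> borel_measurable M"
    unfolding Z_def by measurable
  have "AE w in M. ennreal (U 0 w) \<le> Z w"
  proof (rule AE_le_of_geometric_remainder[where r = r and \<theta> = \<theta>])
    have [measurable]: "snd \<in> borel_measurable (borel :: (real \<times> real) measure)"
      by (intro borel_measurable_continuous_onI continuous_on_snd continuous_on_id)
    have "(\<lambda>x :: real \<times> real. exp (s * \<bar>ln ((snd x)\<^sup>2)\<bar>)) \<in> borel_measurable borel"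
      by measurable
    then show "distr M borel (U t) = distr M borel (U 0)" for t
      unfolding U_def
      using strictly_stationary_marginal[OF assms(15), of "\<lambda>x. exp (s * \<bar>ln ((snd x)\<^sup>2)\<bar>)" t] by simp
    fix n
    show "AE w in M. ennreal (U 0 w) \<le> ennreal (\<theta> ^ n * (\<Sum>i<r. U (- int n - int i) w)) + Z w"
      using rec
    proof eventually_elim
      case (elim w)
      \<comment> \<open>Started at time -n and run for n steps, the recursion ends at time 0, and
        \<open>V\<close> is read at the times -l.\<close>
      have "U (- int n + int n) w \<le> \<theta> ^ n * (\<Sum>i<r. U (- int n - int i) w) +
          (\<Sum>l<n. \<theta> ^ l * V (- int n + int n - int l) w)"
        by (rule recursive_inequality_bound[of r c \<theta> "\<lambda>t. U t w" "\<lambda>t. V t w"])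
           (use elim r c \<theta> U0 V0 in auto)
      then have "ennreal (U 0 w) \<le> ennreal (\<theta> ^ n * (\<Sum>i<r. U (- int n - int i) w) +
          (\<Sum>l<n. \<theta> ^ l * V (- int l) w))"
        by (intro ennreal_leI) simp
      also have "\<dots> = ennreal (\<theta> ^ n * (\<Sum>i<r. U (- int n - int i) w)) +
          (\<Sum>l<n. ennreal (\<theta> ^ l * V (- int l) w))"
      proof -
        have "(\<Sum>l<n. ennreal (\<theta> ^ l * V (- int l) w)) = ennreal (\<Sum>l<n. \<theta> ^ l * V (- int l) w)"
          using \<theta> V0 by (intro sum_ennreal) simp
        moreover have "0 \<le> \<theta> ^ n * (\<Sum>i<r. U (- int n - int i) w)"
          using \<theta> U0 by (intro mult_nonneg_nonneg sum_nonneg) auto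
        moreover have "0 \<le> (\<Sum>l<n. \<theta> ^ l * V (- int l) w)"
          using \<theta> V0 by (intro mult_nonneg_nonneg sum_nonneg) auto
        ultimately show ?thesis by (simp only: ennreal_plus)
      qed
      also have "(\<Sum>l<n. ennreal (\<theta> ^ l * V (- int l) w)) \<le> Z w"
        unfolding Z_def by (intro sum_le_suminf) auto
      finally show ?case by (simp add: add_left_mono)
    qed
  qed (use \<theta> U0 in auto)

  \<comment> \<open>From the volatility to \<epsilon> at time 0\<close>
  with solution have "AE w in M. ennreal (\<bar>\<epsilon> 0 w\<bar> powr (2 * s)) \<le> Z w * ennreal (g (\<eta> 0 w))"
  proof eventually_elim
    case (elim w)
    then have \<sigma>: "0 < \<sigma> 0 w" and \<epsilon>: "\<epsilon> 0 w = \<sigma> 0 w * \<eta> 0 w" and UZ: "ennreal (U 0 w) \<le> Z w"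
      by auto
    \<comment> \<open>The logarithm of the product splits only for \<eta> \<noteq> 0; otherwise the
      left side is a power of 0, hence 0.\<close>
    have "\<bar>\<epsilon> 0 w\<bar> powr (2 * s) \<le> U 0 w * g (\<eta> 0 w)"
    proof (cases "\<eta> 0 w = 0")
      case False
      have "\<bar>\<epsilon> 0 w\<bar> powr (2 * s) = exp (s * ln ((\<sigma> 0 w)\<^sup>2)) * exp (s * ln ((\<eta> 0 w)\<^sup>2))"
      proof -
        have "ln ((\<epsilon> 0 w)\<^sup>2) = 2 * ln \<bar>\<epsilon> 0 w\<bar>"
          using ln_realpow[of "\<bar>\<epsilon> 0 w\<bar>" 2] False \<sigma> by (simp add: \<epsilon>)
        moreover have "ln ((\<epsilon> 0 w)\<^sup>2) = ln ((\<sigma> 0 w)\<^sup>2) + ln ((\<eta> 0 w)\<^sup>2)"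
          using False \<sigma> by (simp add: \<epsilon> power_mult_distrib ln_mult)
        moreover have "\<bar>\<epsilon> 0 w\<bar> powr (2 * s) = exp (s * (2 * ln \<bar>\<epsilon> 0 w\<bar>))"
          using False \<sigma> by (simp add: \<epsilon> powr_def mult_ac)
        ultimately show ?thesis
          by (simp only: exp_add[symmetric] distrib_left[symmetric])
      qed
      also have "\<dots> \<le> U 0 w * g (\<eta> 0 w)"
        unfolding U_def g_def
      proof (intro mult_mono)
        \<comment> \<open>The innovation at time 0 enters with exponent s rather than s \<lambda>;
          the maximum with 1 in the moment hypothesis covers it.\<close>
        have "ln ((\<eta> 0 w)\<^sup>2) \<le> \<Lambda> * \<bar>ln ((\<eta> 0 w)\<^sup>2)\<bar>"
          using mult_right_mono[OF \<Lambda>(2), of "\<bar>ln ((\<eta> 0 w)\<^sup>2)\<bar>"] by linarith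
        then show "exp (s * ln ((\<eta> 0 w)\<^sup>2)) \<le> exp (s * \<Lambda> * \<bar>ln ((\<eta> 0 w)\<^sup>2)\<bar>)"
          using assms(12) by (simp add: mult.assoc)
      qed (use assms(12) in auto)
      finally show ?thesis .
    qed (simp add: \<epsilon> U0 g0)
    then have "ennreal (\<bar>\<epsilon> 0 w\<bar> powr (2 * s)) \<le> ennreal (U 0 w) * ennreal (g (\<eta> 0 w))"
      unfolding ennreal_mult[OF U0 g0, symmetric] by (rule ennreal_leI)
    also have "\<dots> \<le> Z w * ennreal (g (\<eta> 0 w))"
      by (intro mult_right_mono UZ) simp
    finally show ?case .
  qed

  \<comment> \<open>Expectation of the series bound\<close>
  then have "(\<integral>\<^sup>+ w. ennreal (\<bar>\<epsilon> 0 w\<bar> powr (2 * s)) \<partial>M) \<le> (\<integral>\<^sup>+ w. Z w * ennreal (g (\<eta> 0 w)) \<partial>M)"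
    by (rule nn_integral_mono_AE)
  \<comment> \<open>\<open>V\<close> at time -l reads \<eta> at -l-1, ..., -l-q, all before 0. With
    time 0 these are q + 1 distinct times, so independence yields the same (q + 1)-th power for
    every l.\<close>
  also have "\<dots> = (\<integral>\<^sup>+ w. (\<Sum>l. ennreal (\<theta> ^ l * D) * (\<Prod>j \<in> insert 0 ((\<lambda>i. - int l - int i) ` {1..q}). ennreal (g (\<eta> j w)))) \<partial>M)"
  proof (intro nn_integral_cong)
    fix w
    have "ennreal (\<theta> ^ l * V (- int l) w) * ennreal (g (\<eta> 0 w)) =
        ennreal (\<theta> ^ l * D) * (\<Prod>j \<in> insert 0 ((\<lambda>i. - int l - int i) ` {1..q}). ennreal (g (\<eta> j w)))" for l
    proof -
      have "(\<Prod>j \<in> insert 0 ((\<lambda>i. - int l - int i) ` {1..q}). g (\<eta> j w)) =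
          g (\<eta> 0 w) * (\<Prod>i = 1..q. g (\<eta> (- int l - int i) w))"
        by (subst prod.insert) (auto simp: prod.reindex inj_on_def)
      then have "\<theta> ^ l * V (- int l) w * g (\<eta> 0 w) =
          \<theta> ^ l * D * (\<Prod>j \<in> insert 0 ((\<lambda>i. - int l - int i) ` {1..q}). g (\<eta> j w))"
        by (simp add: V_def mult_ac)
      then have "ennreal (\<theta> ^ l * V (- int l) w * g (\<eta> 0 w)) =
          ennreal (\<theta> ^ l * D * (\<Prod>j \<in> insert 0 ((\<lambda>i. - int l - int i) ` {1..q}). g (\<eta> j w)))"
        by (rule arg_cong)
      then show ?thesis
        using \<theta> V0 g0 D_def
        by (simp only: ennreal_mult mult_nonneg_nonneg zero_le_power less_imp_le prod_nonneg prod_ennreal exp_ge_zero)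
    qed
    then show "Z w * ennreal (g (\<eta> 0 w)) =
        (\<Sum>l. ennreal (\<theta> ^ l * D) * (\<Prod>j \<in> insert 0 ((\<lambda>i. - int l - int i) ` {1..q}). ennreal (g (\<eta> j w))))"
      by (simp only: Z_def ennreal_suminf_multc[symmetric])
  qed
  also have "\<dots> = (\<Sum>l. ennreal (\<theta> ^ l * D) * (\<integral>\<^sup>+ w. ennreal (g (\<eta> 0 w)) \<partial>M) ^ (q + 1))"
  proof -
    have "(\<integral>\<^sup>+ w. ennreal (\<theta> ^ l * D) * (\<Prod>j \<in> insert 0 ((\<lambda>i. - int l - int i) ` {1..q}). ennreal (g (\<eta> j w))) \<partial>M) =
        ennreal (\<theta> ^ l * D) * (\<integral>\<^sup>+ w. ennreal (g (\<eta> 0 w)) \<partial>M) ^ (q + 1)" for l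
    proof -
      have "card (insert 0 ((\<lambda>i. - int l - int i) ` {1..q})) = q + 1"
        by (subst card_insert_disjoint) (auto simp: card_image inj_on_def)
      then show ?thesis
        using nn_integral_prod_iid[OF iid, of "\<lambda>x. ennreal (g x)" "insert 0 ((\<lambda>i. - int l - int i) ` {1..q})"]
        by (subst nn_integral_cmult) auto
    qed
    then show ?thesis by (subst nn_integral_suminf) simp_all
  qed
  also have "\<dots> = (\<Sum>l. ennreal (\<theta> ^ l * D)) * (\<integral>\<^sup>+ w. ennreal (g (\<eta> 0 w)) \<partial>M) ^ (q + 1)"
    by (rule ennreal_suminf_multc)
  also have "\<dots> < \<infinity>"
  proof -
    \<comment> \<open>At x = 0 the left side is 1, by \<open>ln 0 = 0\<close>, and the right side is
      \<infinity>, by the convention in \<open>elog\<close>; elsewhere both agree.\<close>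
    have "ennreal (g x) \<le> eexp (ereal (s * \<Lambda>) * \<bar>elog (x\<^sup>2)\<bar>)" for x
      using assms(12) \<Lambda> by (simp add: g_def elog_def eexp_def)
    then have "(\<integral>\<^sup>+ w. ennreal (g (\<eta> 0 w)) \<partial>M) \<le>
        (\<integral>\<^sup>+ w. eexp (ereal (s * \<Lambda>) * \<bar>elog ((\<eta> 0 w)\<^sup>2)\<bar>) \<partial>M)"
      by (rule nn_integral_mono)
    also have "\<dots> < \<infinity>"
      using assms(13) unfolding \<Lambda>_def .
    finally have "(\<integral>\<^sup>+ w. ennreal (g (\<eta> 0 w)) \<partial>M) < \<infinity>" .
    moreover have "(\<Sum>l. ennreal (\<theta> ^ l * D)) < \<infinity>"
    proof -
      have "summable (\<lambda>l. \<theta> ^ l * D)"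
        using \<theta> by (intro summable_mult2) (simp add: summable_geometric)
      moreover have "0 \<le> \<theta> ^ l * D" for l
        using \<theta> by (simp add: D_def)
      ultimately have "(\<Sum>l. ennreal (\<theta> ^ l * D)) = ennreal (\<Sum>l. \<theta> ^ l * D)"
        by (intro suminf_ennreal2)
      then show ?thesis by simp
    qed
    ultimately show ?thesis
      by (simp add: ennreal_mult_less_top power_less_top_ennreal)
  qed
  finally show ?thesis using summable by (simp add: A)
qed

end
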